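(* Let $\mathcal{G}$ be a finite abelian group of order $G$, let $\mathcal{D}$ be a nonempty difference set for $\mathcal{G}$ with $D=\#(\mathcal{D})$ elements, and let $\mathcal{H}$ be any subgroup of $\mathcal{G}$, of order $H$, that is disjoint from $\mathcal{D}$. Then $H\leq\frac{G}{S+1}$ where $S=\left[\frac{D(G-1)}{G-D}\right]^{1/2}$. Moreover, the following are equivalent: (i) $H=\frac{G}{S+1}$, that is, $\mathcal{D}$ is $\mathcal{H}$-fine; (ii) $(\mathbf{F}^*\chi_{\mathcal{D}})(\gamma)=-\frac{D}{S}$ for all $\gamma\in\mathcal{H}^\perp$, $\gamma\neq1$; (iii) $\#(\mathcal{D}_g)=\frac{D}{S}$ for all $g\notin\mathcal{H}$, where $\mathcal{D}_g:=\mathcal{H}\cap(\mathcal{D}-g)$; i.e., $\chi_{\mathcal{D}}*\chi_{\mathcal{H}}=\frac{D}{S}\chi_{\mathcal{H}^{\mathrm{c}}}$. As a consequence, if $\mathcal{D}$ is fine then $S$ is necessarily an integer that divides $D$, implying that the order $D-\Lambda=\frac{D^2}{S^2}$ of $\mathcal{D}$, where $\Lambda=\frac{D(D-1)}{G-1}$, is necessarily a perfect square.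
   Context: Groups $\mathcal{G}$ are written additively. A subset $\mathcal{D}$ of a finite abelian group $\mathcal{G}$ is a difference set for $\mathcal{G}$ if every nonzero $g\in\mathcal{G}$ can be written as $g=d-d'$ with $(d,d')\in\mathcal{D}\times\mathcal{D}$ in the same number $\Lambda$ of ways; then $\Lambda=\frac{D(D-1)}{G-1}$, where $D=\#(\mathcal{D})$ and $G=\#(\mathcal{G})$. $\hat{\mathcal{G}}$ is the (multiplicative) group of characters $\gamma:\mathcal{G}\to\{z\in\mathbb{C}:|z|=1\}$, with identity $1$. For $\mathbf{x}:\mathcal{G}\to\mathbb{C}$, the discrete Fourier transform is $(\mathbf{F}^*\mathbf{x})(\gamma)=\sum_{g\in\mathcal{G}}\overline{\gamma(g)}\,\mathbf{x}(g)$ for $\gamma\in\hat{\mathcal{G}}$. For a subgroup $\mathcal{H}$, $\mathcal{H}^\perp=\{\gamma\in\hat{\mathcal{G}}:\gamma(h)=1\ \forall h\in\mathcal{H}\}$. For a subset $\mathcal{X}$ of $\mathcal{G}$, $\chi_{\mathcal{X}}:\mathcal{G}\to\mathbb{C}$ is its characteristic function, and $\mathcal{X}^{\mathrm{c}}=\mathcal{G}\setminus\mathcal{X}$. Convolution is $(\mathbf{x}_1*\mathbf{x}_2)(g)=\sum_{g'\in\mathcal{G}}\mathbf{x}_1(g')\mathbf{x}_2(g-g')$. A (nonempty) $D$-element difference set $\mathcal{D}$ for an abelian group $\mathcal{G}$ of order $G$ is $\mathcal{H}$-fine, for a subgroup $\mathcal{H}$ of $\mathcal{G}$, if $\mathcal{D}\cap\mathcal{H}=\emptyset$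 and $\mathcal{H}$ has order $H=\frac{G}{S+1}$, where $S=\left[\frac{D(G-1)}{G-D}\right]^{1/2}$. It is fine if it is $\mathcal{H}$-fine for some subgroup $\mathcal{H}$. *)

theory Defs
  imports Complex_Main "HOL-Library.Indicator_Function" "HOL-Algebra.Coset"
begin

text \<open>Groups are the commutative groups of HOL-Algebra, hence written multiplicatively:
  the difference \<open>g - g'\<close> of the additive notation is \<open>g \<otimes> inv g'\<close>.\<close>

definition difference_reps :: "('a, 'b) monoid_scheme \<Rightarrow> 'a set \<Rightarrow> 'a \<Rightarrow> ('a \<times> 'a) set"
  where "difference_reps G D g = {(d, d') \<in> D \<times> D. g = d \<otimes>\<^bsub>G\<^esub> inv\<^bsub>G\<^esub> d'}"

definition difference_set :: "('a, 'b) monoid_scheme \<Rightarrow> 'a set \<Rightarrow> bool"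
  where "difference_set G D \<longleftrightarrow> D \<subseteq> carrier G \<and>
    (\<exists>n::nat. \<forall>g \<in> carrier G - {\<one>\<^bsub>G\<^esub>}. card (difference_reps G D g) = n)"

definition diffset_Lambda :: "('a, 'b) monoid_scheme \<Rightarrow> 'a set \<Rightarrow> real"
  where "diffset_Lambda G D = real (card D) * (real (card D) - 1) / (real (order G) - 1)"

definition diffset_S :: "('a, 'b) monoid_scheme \<Rightarrow> 'a set \<Rightarrow> real"
  where "diffset_S G D =
    sqrt (real (card D) * (real (order G) - 1) / (real (order G) - real (card D)))"

definition fine_wrt :: "('a, 'b) monoid_scheme \<Rightarrow> 'a set \<Rightarrow> 'a set \<Rightarrow> bool"
  where "fine_wrt G H D \<longleftrightarrow> difference_set G D \<and> D \<noteq> {} \<and> subgroup H G \<and> D \<inter> H = {} \<and>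
    real (card H) = real (order G) / (diffset_S G D + 1)"

definition fine :: "('a, 'b) monoid_scheme \<Rightarrow> 'a set \<Rightarrow> bool"
  where "fine G D \<longleftrightarrow> (\<exists>H. fine_wrt G H D)"

definition circle_group :: "complex monoid"
  where "circle_group = \<lparr>carrier = {z. cmod z = 1}, mult = (*), one = 1\<rparr>"

text \<open>Characters are taken to be \<open>undefined\<close> off the carrier, so that equality of characters
  is equality of functions on the carrier.\<close>

definition dual_group :: "('a, 'b) monoid_scheme \<Rightarrow> ('a \<Rightarrow> complex) monoid"
  where "dual_group G =
    \<lparr>carrier = hom G circle_group \<inter> extensional (carrier G),
     mult = (\<lambda>\<gamma> \<gamma>'. \<lambda>g \<in> carrier G. \<gamma> g * \<gamma>' g),
     one = (\<lambda>g \<in> carrier G. 1)\<rparr>"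

definition annihilator :: "('a, 'b) monoid_scheme \<Rightarrow> 'a set \<Rightarrow> ('a \<Rightarrow> complex) set"
  where "annihilator G H = {\<gamma> \<in> carrier (dual_group G). \<forall>h \<in> H. \<gamma> h = 1}"

definition dft :: "('a, 'b) monoid_scheme \<Rightarrow> ('a \<Rightarrow> complex) \<Rightarrow> ('a \<Rightarrow> complex) \<Rightarrow> complex"
  where "dft G x \<gamma> = (\<Sum>g \<in> carrier G. cnj (\<gamma> g) * x g)"

definition convolution ::
  "('a, 'b) monoid_scheme \<Rightarrow> ('a \<Rightarrow> complex) \<Rightarrow> ('a \<Rightarrow> complex) \<Rightarrow> 'a \<Rightarrow> complex"
  where "convolution G x y g = (\<Sum>g' \<in> carrier G. x g' * y (g \<otimes>\<^bsub>G\<^esub> inv\<^bsub>G\<^esub> g'))"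

end

theory Submission imports Defs "HOL-Algebra.Multiplicative_Group"
begin

text \<open>Let \<open>m g = card (H \<inter> (D - g))\<close>. It vanishes on \<open>H\<close>, and its first two moments over the group are
  determined by \<open>D\<close> being a difference set, since \<open>\<Sum>\<^sub>g (m g)\<^sup>2\<close> counts differences lying in \<open>H\<close>.
  With \<open>N\<close> and \<open>h\<close> the orders of the group and of \<open>H\<close>, and \<open>t = N / h - 1\<close>, the variance of \<open>m\<close> off \<open>H\<close> turns out to be a positive multiple of
  \<open>t\<^sup>2 - S\<^sup>2\<close>, which gives both the bound \<open>S \<le> t\<close> and the equivalence of (i) and (iii).
  Condition (iii) gives (ii) by transforming \<open>m\<close>; conversely, the values of the transform of \<open>D\<close> on the
  annihilator of \<open>H\<close> sum to \<open>0\<close> because \<open>D\<close> misses \<open>H\<close>, so (ii) forces \<open>t = S\<close>.\<close>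

section \<open>Translation of sums, and counting representations as differences\<close>

lemma (in group) sum_translate:
  assumes "a \<in> carrier G"
  shows "(\<Sum>g \<in> carrier G. f (a \<otimes> g)) = (\<Sum>g \<in> carrier G. f g)"
proof (rule sum.reindex_bij_betw)
  show "bij_betw (\<lambda>g. a \<otimes> g) (carrier G) (carrier G)"
    using assms inj_on_cmult surj_const_mult by (simp add: bij_betw_def)
qed

lemma card_eq_sum_indicator:
  assumes "finite A"
  shows "of_nat (card (A \<inter> B)) = (\<Sum>x \<in> A. indicator B x :: 'c :: semiring_1)"
  using assms by (simp add: indicator_def of_bool_def sum.If_cases Int_def)

text \<open>A representation of \<open>x\<close> is determined by its second entry \<open>g\<close>,
  the first being \<open>x \<otimes> g\<close>. The count is thus an autocorrelation of the
  indicator of \<open>D\<close>.\<close>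

lemma (in group) card_difference_reps:
  assumes "finite (carrier G)" "D \<subseteq> carrier G" "x \<in> carrier G"
  shows "real (card (difference_reps G D x)) =
    (\<Sum>g \<in> carrier G. indicator D (x \<otimes> g) * indicator D g)"
proof -
  have "bij_betw snd (difference_reps G D x) {g \<in> carrier G. x \<otimes> g \<in> D \<and> g \<in> D}"
    using assms(2,3)
    by (intro bij_betwI[where g = "\<lambda>g. (x \<otimes> g, g)"])
      (auto simp: difference_reps_def subset_eq m_assoc)
  then have "card (difference_reps G D x) =
      card (carrier G \<inter> {g. x \<otimes> g \<in> D \<and> g \<in> D})"
    by (simp add: bij_betw_same_card Int_def)
  then show ?thesis
    using card_eq_sum_indicator[OF assms(1), of "{g. x \<otimes> g \<in> D \<and> g \<in> D}", where 'c = real]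
    by (simp add: indicator_def of_bool_conj)
qed

lemma (in group) card_difference_reps_one:
  assumes "D \<subseteq> carrier G"
  shows "card (difference_reps G D \<one>) = card D"
proof -
  have "\<one> = d \<otimes> inv d' \<longleftrightarrow> d = d'" if "d \<in> D" "d' \<in> D" for d d'
    using that assms inv_solve_right[of \<one> d d'] by (auto simp: subset_eq)
  then have "difference_reps G D \<one> = (\<lambda>d. (d, d)) ` D"
    by (auto simp: difference_reps_def)
  then show ?thesis
    by (simp add: card_image inj_on_def)
qed

text \<open>Double counting of the pairs in \<open>D\<close>: each pair represents exactly one group
  element, the identity takes the \<open>card D\<close> diagonal pairs, and every other element
  takes the same number \<open>n\<close>.\<close>

lemma (in comm_group) card_difference_set_reps:
  assumes "finite (carrier G)" "difference_set G D" "g \<in> carrier G - {\<one>}"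
  shows "real (card (difference_reps G D g)) = diffset_Lambda G D"
proof -
  obtain n where D: "D \<subseteq> carrier G"
    and n: "\<And>g. g \<in> carrier G - {\<one>} \<Longrightarrow> card (difference_reps G D g) = n"
    using assms(2) by (auto simp: difference_set_def)
  have "real (card D) * real (card D) =
      (\<Sum>g \<in> carrier G. indicator D g) * (\<Sum>x \<in> carrier G. indicator D x)"
    using card_eq_sum_indicator[OF assms(1), of D, where 'c = real] D by (simp add: Int_absorb1)
  also have "\<dots> = (\<Sum>g \<in> carrier G. \<Sum>x \<in> carrier G. indicator D (x \<otimes> g) * indicator D g)"
  proof -
    have "(\<Sum>x \<in> carrier G. indicator D (x \<otimes> g)) = (\<Sum>x \<in> carrier G. indicator D x :: real)"
      if "g \<in> carrier G" for g
      using sum_translate[OF that, of "indicator D"] that by (simp add: m_comm cong: sum.cong)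
    then show ?thesis
      by (simp add: sum_distrib_right[symmetric] sum_distrib_left[symmetric] mult.commute)
  qed
  also have "\<dots> = (\<Sum>x \<in> carrier G. real (card (difference_reps G D x)))"
    by (subst sum.swap) (simp add: card_difference_reps assms D)
  also have "\<dots> = real (card D) + (\<Sum>x \<in> carrier G - {\<one>}. real n)"
    using assms(1) D by (simp add: sum.remove[of _ \<one>] card_difference_reps_one n)
  also have "\<dots> = real (card D) + (real (order G) - 1) * real n"
  proof -
    have "0 < order G" using assms(1) by (simp add: order_gt_0_iff_finite)
    then show ?thesis by (simp add: order_def assms(1) of_nat_diff)
  qed
  finally have "real (card D) * (real (card D) - 1) = real n * (real (order G) - 1)"
    by (simp add: algebra_simps)
  \<comment> \<open>A nonidentity element exists, so the denominator of
    \<open>diffset_Lambda\<close> is not 0.\<close>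
  moreover have "order G \<noteq> 1"
    using assms(3) one_closed by (metis Diff_iff card_1_singletonE order_def singleton_iff)
  ultimately show ?thesis
    using n[OF assms(3)] by (simp add: diffset_Lambda_def)
qed

section \<open>Extension of characters and separation of points from a subgroup\<close>

text \<open>Here \<open>m\<close> is the order of \<open>x\<close> modulo \<open>K\<close>. The only
  constraint on a value \<open>w\<close> at \<open>x\<close> is \<open>w ^ m = f (x [^] m)\<close>,
  because a power of \<open>x\<close> lies in \<open>K\<close> only if its exponent is a multiple of
  \<open>m\<close>.\<close>

lemma (in comm_group) extend_character:
  assumes K: "subgroup K G" and f: "f \<in> hom (G\<lparr>carrier := K\<rparr>) circle_group"
    and x: "x \<in> carrier G" and m: "0 < m" "x [^] (m::nat) \<in> K"
    and least: "\<And>j::nat. 0 < j \<Longrightarrow> x [^] j \<in> K \<Longrightarrow> m \<le> j"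
    and w: "w ^ m = f (x [^] m)"
  obtains K' f' where "subgroup K' G" "K \<subseteq> K'" "x \<in> K'"
    "f' \<in> hom (G\<lparr>carrier := K'\<rparr>) circle_group" "\<And>a. a \<in> K \<Longrightarrow> f' a = f a" "f' x = w"
proof -
  have K_carrier: "a \<in> carrier G" if "a \<in> K" for a
    using subgroup.mem_carrier[OF K that] .
  have f_mult: "f (a \<otimes> b) = f a * f b" if "a \<in> K" "b \<in> K" for a b
    using f that by (simp add: hom_def circle_group_def)
  have f_norm: "cmod (f a) = 1" if "a \<in> K" for a
    using f that by (auto simp: hom_def circle_group_def)
  have f_one: "f \<one> = 1"
    using f_mult[of \<one> \<one>] f_norm[of \<one>] subgroup.one_closed[OF K] by force
  have pow_in: "a [^] q \<in> K" if "a \<in> K" for a and q :: nat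
    by (induction q) (auto simp: subgroup.one_closed[OF K] subgroup.m_closed[OF K] that)
  have f_pow: "f (a [^] q) = f a ^ q" if "a \<in> K" for a and q :: nat
  proof (induction q)
    case (Suc q)
    then show ?case using pow_in that by (simp add: f_mult)
  qed (simp add: f_one)
  \<comment> \<open>Division with remainder: \<open>x [^] (j mod m)\<close> also lies in
    \<open>K\<close>, so minimality of \<open>m\<close> makes the remainder 0.\<close>
  have dvd: "m dvd j" if j: "x [^] j \<in> K" for j :: nat
  proof -
    have "x [^] j = (x [^] m) [^] (j div m) \<otimes> x [^] (j mod m)"
      using x by (simp add: nat_pow_pow nat_pow_mult)
    moreover have "(x [^] m) [^] (j div m) \<in> K"
      by (rule pow_in[OF m(2)])
    ultimately have "x [^] (j mod m) \<in> K"
      using j x K by (metis inv_solve_left nat_pow_closed subgroup.m_closed subgroup.m_inv_closed)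
    then show ?thesis
      using least[of "j mod m"] m(1) by (metis dvd_eq_mod_eq_0 gr0I linorder_not_less mod_less_divisor)
  qed
  have f_x_pow: "f (x [^] j) = w ^ j" if j: "x [^] j \<in> K" for j :: nat
  proof -
    obtain q where "j = m * q" using dvd[OF j] by blast
    then show ?thesis
      using f_pow[OF m(2), of q] w x by (simp add: nat_pow_pow power_mult)
  qed
  define K' where "K' = {a \<otimes> x [^] i | a (i::nat). a \<in> K}"
  define f' where "f' y = (THE z. \<exists>a\<in>K. \<exists>i::nat. y = a \<otimes> x [^] i \<and> z = f a * w ^ i)" for y
  \<comment> \<open>The value chosen for \<open>f'\<close> does not depend on the representation:
    cancelling \<open>x [^] i\<close> puts \<open>x [^] (j - i)\<close> into \<open>K\<close>, where
    \<open>f_x_pow\<close> evaluates \<open>f\<close>.\<close>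
  have aux: "f a * w ^ i = f b * w ^ j"
    if "a \<in> K" "b \<in> K" "a \<otimes> x [^] i = b \<otimes> x [^] j" "i \<le> j" for a b and i j :: nat
  proof -
    have "x [^] j = x [^] (j - i) \<otimes> x [^] i"
      using x \<open>i \<le> j\<close> by (simp add: nat_pow_mult)
    then have *: "a = b \<otimes> x [^] (j - i)"
      using that x K_carrier by (metis m_assoc m_closed nat_pow_closed right_cancel)
    then have "x [^] (j - i) = inv b \<otimes> a"
      using that x K_carrier by (simp add: m_assoc[symmetric])
    then have "x [^] (j - i) \<in> K"
      using that K by (simp add: subgroup.m_closed subgroup.m_inv_closed)
    then have "f a = f b * w ^ (j - i)"
      using * f_mult f_x_pow that by simp
    then show ?thesis
      using \<open>i \<le> j\<close> by (simp add: power_add[symmetric])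
  qed
  have f'_eq: "f' (a \<otimes> x [^] i) = f a * w ^ i" if "a \<in> K" for a and i :: nat
    unfolding f'_def
  proof (rule the_equality)
    fix z assume "\<exists>b\<in>K. \<exists>j::nat. a \<otimes> x [^] i = b \<otimes> x [^] j \<and> z = f b * w ^ j"
    then show "z = f a * w ^ i" using that aux by (metis nat_le_linear)
  qed (use that in blast)
  have w_norm: "cmod w = 1"
  proof -
    have "cmod w ^ m = 1" using w f_norm[OF m(2)] by (simp add: norm_power[symmetric])
    then show ?thesis using m(1) by (intro power_eq_imp_eq_base[of "cmod w" m 1]) auto
  qed
  have mult: "(a \<otimes> x [^] i) \<otimes> (b \<otimes> x [^] j) = (a \<otimes> b) \<otimes> x [^] (i + j)"
    if "a \<in> K" "b \<in> K" for a b and i j :: nat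
    using that x K_carrier by (simp add: nat_pow_mult[symmetric] m_ac)
  \<comment> \<open>Exponents are natural numbers, so an inverse power is rewritten as the inverse
    of \<open>x [^] (m * i)\<close>, an element of \<open>K\<close>, times
    \<open>x [^] (m * i - i)\<close>.\<close>
  have x_pow: "\<exists>a\<in>K. \<exists>j::nat. inv (x [^] i) = a \<otimes> x [^] j" for i :: nat
  proof -
    have "inv (x [^] i) = inv (x [^] (m * i)) \<otimes> x [^] (m * i - i)"
    proof -
      have "x [^] (m * i - i) \<otimes> x [^] i = x [^] (m * i)"
      proof -
        have "i \<le> m * i" using m(1) by simp
        then show ?thesis using nat_pow_mult[OF x, of "m * i - i" i] by simp
      qed
      then have "inv (x [^] (m * i)) \<otimes> x [^] (m * i - i) \<otimes> x [^] i = \<one>"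
        using x by (simp add: m_assoc)
      then show ?thesis using x by (simp add: inv_equality)
    qed
    moreover have "x [^] (m * i) \<in> K"
      unfolding nat_pow_pow[OF x, symmetric] by (rule pow_in[OF m(2)])
    ultimately show ?thesis using subgroup.m_inv_closed[OF K] by blast
  qed
  have "subgroup K' G"
  proof (rule subgroupI)
    show "K' \<subseteq> carrier G" using x K_carrier by (auto simp: K'_def)
    show "K' \<noteq> {}" using subgroup.one_closed[OF K] by (auto simp: K'_def)
  next
    fix y assume "y \<in> K'"
    then obtain a and i :: nat where y: "a \<in> K" "y = a \<otimes> x [^] i" by (auto simp: K'_def)
    obtain b and j :: nat where b: "b \<in> K" "inv (x [^] i) = b \<otimes> x [^] j" using x_pow by blast
    have "inv y = (inv a \<otimes> b) \<otimes> x [^] j"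
      using x y b K_carrier by (simp add: inv_mult m_assoc)
    then show "inv y \<in> K'"
      using y b K unfolding K'_def by (blast intro: subgroup.m_closed subgroup.m_inv_closed)
  next
    fix y z assume "y \<in> K'" "z \<in> K'"
    then show "y \<otimes> z \<in> K'"
      unfolding K'_def using mult subgroup.m_closed[OF K] by blast
  qed
  moreover have "K \<subseteq> K'"
  proof
    fix a assume "a \<in> K"
    then show "a \<in> K'" unfolding K'_def using K_carrier by (force intro!: exI[of _ "0::nat"])
  qed
  moreover have "x \<in> K'"
    unfolding K'_def using x subgroup.one_closed[OF K] by (force intro!: exI[of _ "1::nat"])
  moreover have "f' \<in> hom (G\<lparr>carrier := K'\<rparr>) circle_group"
  proof (rule homI)
    fix y assume "y \<in> carrier (G\<lparr>carrier := K'\<rparr>)"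
    then show "f' y \<in> carrier circle_group"
      by (auto simp: K'_def f'_eq circle_group_def norm_mult norm_power f_norm w_norm)
  next
    fix y z assume "y \<in> carrier (G\<lparr>carrier := K'\<rparr>)" "z \<in> carrier (G\<lparr>carrier := K'\<rparr>)"
    then show "f' (y \<otimes>\<^bsub>G\<lparr>carrier := K'\<rparr>\<^esub> z) = f' y \<otimes>\<^bsub>circle_group\<^esub> f' z"
      using subgroup.m_closed[OF K]
      by (auto simp: K'_def mult f'_eq circle_group_def f_mult power_add)
  qed
  moreover have "f' a = f a" if "a \<in> K" for a
    using f'_eq[OF that, of 0] that K_carrier by simp
  moreover have "f' x = w"
    using f'_eq[OF subgroup.one_closed[OF K], of 1] x by (simp add: f_one)
  ultimately show ?thesis by (rule that)
qed

lemma (in group) least_power_in_subgroup: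
  assumes "finite (carrier G)" "subgroup K G" "x \<in> carrier G"
  obtains m :: nat where "0 < m" "x [^] m \<in> K" "\<And>j::nat. 0 < j \<Longrightarrow> x [^] j \<in> K \<Longrightarrow> m \<le> j"
proof -
  let ?P = "\<lambda>m::nat. 0 < m \<and> x [^] m \<in> K"
  have "?P (order G)"
    using assms(1,3) subgroup.one_closed[OF assms(2)] by (simp add: pow_order_eq_1 order_gt_0_iff_finite)
  from LeastI[of ?P, OF this] show ?thesis
    by (intro that[of "Least ?P"]) (auto intro: Least_le)
qed

text \<open>Starting from a character of the subgroup generated by \<open>H\<close> and \<open>d\<close>, extend to a maximal
  subgroup, which must be the whole group.\<close>
lemma (in comm_group) ex_annihilator_neq_1:
  assumes fin: "finite (carrier G)" and H: "subgroup H G" and d: "d \<in> carrier G" "d \<notin> H"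
  shows "\<exists>\<gamma> \<in> annihilator G H. \<gamma> d \<noteq> 1"
proof -
  \<comment> \<open>Only the existence of a suitable character is recorded, so maximality refers to
    inclusion in a finite family of subsets.\<close>
  define \<K> where "\<K> = {K. subgroup K G \<and> H \<subseteq> K \<and> d \<in> K \<and>
    (\<exists>f \<in> hom (G\<lparr>carrier := K\<rparr>) circle_group. (\<forall>h \<in> H. f h = 1) \<and> f d \<noteq> 1)}"
  have "\<K> \<noteq> {}"
  proof -
    obtain m :: nat where m: "0 < m" "d [^] m \<in> H"
        "\<And>j::nat. 0 < j \<Longrightarrow> d [^] j \<in> H \<Longrightarrow> m \<le> j"
      using least_power_in_subgroup[OF fin H d(1)] by metis
    \<comment> \<open>Hence there are at least two \<open>m\<close>-th roots of unity, and a
      nontrivial one serves as the value at \<open>d\<close> when the trivial character of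
      \<open>H\<close> is extended.\<close>
    have "m \<noteq> 1" using d m(2) by auto
    obtain w :: complex where "w \<noteq> 1" "w ^ m = 1"
    proof -
      have "card {w::complex. w ^ m = 1} \<noteq> card {1::complex}"
        using m(1) \<open>m \<noteq> 1\<close> by (simp add: card_roots_unity_eq)
      then have "{w::complex. w ^ m = 1} \<noteq> {1}" by metis
      moreover have "1 \<in> {w::complex. w ^ m = 1}" by simp
      ultimately show ?thesis using that by blast
    qed
    moreover have "(\<lambda>_. 1) \<in> hom (G\<lparr>carrier := H\<rparr>) circle_group"
      by (simp add: hom_def circle_group_def)
    moreover from this obtain K' f' where "subgroup K' G" "H \<subseteq> K'" "d \<in> K'"
        "f' \<in> hom (G\<lparr>carrier := K'\<rparr>) circle_group" "\<And>a. a \<in> H \<Longrightarrow> f' a = 1" "f' d = w"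
      using extend_character[OF H _ d(1) m, of "\<lambda>_. 1" w] \<open>w ^ m = 1\<close> by metis
    ultimately have "K' \<in> \<K>" unfolding \<K>_def by auto
    then show ?thesis by blast
  qed
  moreover have "finite \<K>"
    using fin by (auto simp: \<K>_def intro!: finite_subset[of _ "Pow (carrier G)"] dest: subgroup.subset)
  ultimately obtain K where K: "K \<in> \<K>" and maximal: "\<And>K'. K' \<in> \<K> \<Longrightarrow> K \<subseteq> K' \<Longrightarrow> K = K'"
    using finite_has_maximal by metis
  then obtain f where sub: "subgroup K G" "H \<subseteq> K" "d \<in> K"
    and f: "f \<in> hom (G\<lparr>carrier := K\<rparr>) circle_group" "\<And>h. h \<in> H \<Longrightarrow> f h = 1" "f d \<noteq> 1"
    by (auto simp: \<K>_def)
  have "x \<in> K" if x: "x \<in> carrier G" for x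
  proof -
    obtain m :: nat where m: "0 < m" "x [^] m \<in> K"
        "\<And>j::nat. 0 < j \<Longrightarrow> x [^] j \<in> K \<Longrightarrow> m \<le> j"
      using least_power_in_subgroup[OF fin sub(1) x] by metis
    let ?z = "f (x [^] m)"
    have "cmod ?z = 1"
      using f(1) m(2) by (auto simp: hom_def circle_group_def)
    \<comment> \<open>The roots are counted only to know that there is one.\<close>
    then have "card {w. w ^ m = ?z} = m"
      using m(1) by (intro card_nth_roots) auto
    then obtain w where "w ^ m = ?z"
      using m(1) by (metis (mono_tags, lifting) card.empty empty_Collect_eq less_irrefl)
    then obtain K' f' where "subgroup K' G" "K \<subseteq> K'" "x \<in> K'"
        "f' \<in> hom (G\<lparr>carrier := K'\<rparr>) circle_group" "\<And>a. a \<in> K \<Longrightarrow> f' a = f a"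
      using extend_character[OF sub(1) f(1) x m] by metis
    moreover from this have "K' \<in> \<K>"
      unfolding \<K>_def using sub f by (auto intro!: bexI[of _ f'])
    ultimately show ?thesis using maximal by blast
  qed
  then have "K = carrier G"
    using subgroup.subset[OF sub(1)] by blast
  \<comment> \<open>Restricting gives the value \<open>undefined\<close> off the carrier, as
    membership in the dual group demands.\<close>
  then have "restrict f (carrier G) \<in> annihilator G H"
    using f sub by (auto simp: annihilator_def dual_group_def hom_def Pi_def)
  moreover have "restrict f (carrier G) d \<noteq> 1"
    using d f by simp
  ultimately show ?thesis by blast
qed

section \<open>Orthogonality relations and the order of the annihilator\<close>

lemma (in comm_group) dual_groupD:
  assumes "\<gamma> \<in> carrier (dual_group G)"
  shows "\<And>a b. a \<in> carrier G \<Longrightarrow> b \<in> carrier G \<Longrightarrow> \<gamma> (a \<otimes> b) = \<gamma> a * \<gamma> b"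
    and "\<And>a. a \<in> carrier G \<Longrightarrow> cmod (\<gamma> a) = 1"
    and "\<gamma> \<in> extensional (carrier G)"
  using assms by (auto simp: dual_group_def hom_def circle_group_def)

text \<open>Translating by an \<open>a\<close> with \<open>\<gamma> a\<close> different from 1
  multiplies the sum by \<open>cnj (\<gamma> a)\<close>, yet leaves it unchanged.\<close>

lemma (in comm_group) sum_character_eq_0:
  assumes \<gamma>: "\<gamma> \<in> carrier (dual_group G)" "\<gamma> \<noteq> \<one>\<^bsub>dual_group G\<^esub>"
  shows "(\<Sum>g \<in> carrier G. cnj (\<gamma> g)) = 0"
proof -
  have "\<exists>a \<in> carrier G. \<gamma> a \<noteq> 1"
    using \<gamma>(2) dual_groupD(3)[OF \<gamma>(1)]
    by (auto simp: dual_group_def intro: extensionalityI[where A = "carrier G"])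
  then obtain a where a: "a \<in> carrier G" "\<gamma> a \<noteq> 1" by blast
  have "(\<Sum>g \<in> carrier G. cnj (\<gamma> g)) = cnj (\<gamma> a) * (\<Sum>g \<in> carrier G. cnj (\<gamma> g))"
    using sum_translate[OF a(1), of "\<lambda>g. cnj (\<gamma> g)"] a(1)
    by (simp add: dual_groupD(1)[OF \<gamma>(1)] sum_distrib_left cong: sum.cong)
  moreover have "cnj (\<gamma> a) \<noteq> 1"
    using a(2) by (metis complex_cnj_cnj complex_cnj_one)
  ultimately show ?thesis by (metis mult_cancel_right1)
qed

text \<open>Characters take values in the roots of unity of exponent \<open>order G\<close>. Being
  extensional, they form a subset of a finite product.\<close>

lemma (in comm_group) finite_dual_group:
  assumes fin: "finite (carrier G)"
  shows "finite (carrier (dual_group G))"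
proof (rule finite_subset)
  let ?n = "order G"
  have "0 < ?n" using fin by (simp add: order_gt_0_iff_finite)
  then show "finite (carrier G \<rightarrow>\<^sub>E {z::complex. z ^ ?n = 1})"
    using fin by (intro finite_PiE) auto
  show "carrier (dual_group G) \<subseteq> carrier G \<rightarrow>\<^sub>E {z. z ^ ?n = 1}"
  proof
    fix \<gamma> assume \<gamma>: "\<gamma> \<in> carrier (dual_group G)"
    have one: "\<gamma> \<one> = 1"
      using dual_groupD(1)[OF \<gamma>, of \<one> \<one>] dual_groupD(2)[OF \<gamma>, of \<one>] by force
    have "\<gamma> g ^ ?n = 1" if "g \<in> carrier G" for g
    proof -
      have "\<gamma> (g [^] i) = \<gamma> g ^ i" for i :: nat
        by (induction i) (auto simp: one that dual_groupD(1)[OF \<gamma>])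
      from this[of ?n] show ?thesis using that by (simp add: pow_order_eq_1 one)
    qed
    then show "\<gamma> \<in> carrier G \<rightarrow>\<^sub>E {z. z ^ ?n = 1}"
      using dual_groupD(3)[OF \<gamma>] by (auto simp: PiE_def)
  qed
qed

lemma (in comm_group) one_in_annihilator:
  assumes "subgroup H G"
  shows "\<one>\<^bsub>dual_group G\<^esub> \<in> annihilator G H"
  using subgroup.subset[OF assms]
  by (auto simp: annihilator_def dual_group_def hom_def circle_group_def)

text \<open>The dual relation: for \<open>d\<close> outside \<open>H\<close>, multiplication by some
  \<open>\<delta>\<close> with \<open>\<delta> d\<close> different from 1 permutes the annihilator
  and multiplies the sum by \<open>cnj (\<delta> d)\<close>.\<close>

lemma (in comm_group) sum_annihilator:
  assumes fin: "finite (carrier G)" and H: "subgroup H G" and d: "d \<in> carrier G"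
  shows "(\<Sum>\<gamma> \<in> annihilator G H. cnj (\<gamma> d)) = (if d \<in> H then of_nat (card (annihilator G H)) else 0)"
proof (cases "d \<in> H")
  case True
  then show ?thesis by (simp add: annihilator_def)
next
  case False
  obtain \<delta> where \<delta>: "\<delta> \<in> annihilator G H" "\<delta> d \<noteq> 1"
    using ex_annihilator_neq_1[OF fin H d False] by blast
  have \<delta>': "\<delta> \<in> carrier (dual_group G)" "\<And>h. h \<in> H \<Longrightarrow> \<delta> h = 1"
    using \<delta>(1) by (auto simp: annihilator_def)
  note \<delta>_props = dual_groupD[OF \<delta>'(1)]
  have \<delta>_nz: "\<delta> g \<noteq> 0" if "g \<in> carrier G" for g
    using \<delta>_props(2)[OF that] by auto
  have H_sub: "h \<in> carrier G" if "h \<in> H" for h using subgroup.mem_carrier[OF H that] .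
  define mul where "mul \<gamma> = (\<lambda>g \<in> carrier G. \<delta> g * \<gamma> g)" for \<gamma> :: "'a \<Rightarrow> complex"
  \<comment> \<open>Pointwise division inverts \<open>mul\<close>, since characters never vanish on
    the carrier. Both functions are cut off outside the carrier to remain extensional.\<close>
  define quo where "quo \<gamma> = (\<lambda>g \<in> carrier G. \<gamma> g / \<delta> g)" for \<gamma> :: "'a \<Rightarrow> complex"
  have "bij_betw mul (annihilator G H) (annihilator G H)"
  proof (rule bij_betwI[where g = quo])
    show "mul \<in> annihilator G H \<rightarrow> annihilator G H"
      using \<delta>'(2) \<delta>_props H_sub
      by (auto simp: annihilator_def dual_group_def hom_def circle_group_def mul_def norm_mult Pi_def)
    show "quo \<in> annihilator G H \<rightarrow> annihilator G H"
      using \<delta>'(2) \<delta>_props H_sub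
      by (auto simp: annihilator_def dual_group_def hom_def circle_group_def quo_def norm_divide Pi_def)
    show "quo (mul \<gamma>) = \<gamma>" if "\<gamma> \<in> annihilator G H" for \<gamma>
      using that \<delta>_nz by (intro extensionalityI[where A = "carrier G"])
        (auto simp: annihilator_def dual_group_def quo_def mul_def)
    show "mul (quo \<gamma>) = \<gamma>" if "\<gamma> \<in> annihilator G H" for \<gamma>
      using that \<delta>_nz by (intro extensionalityI[where A = "carrier G"])
        (auto simp: annihilator_def dual_group_def quo_def mul_def)
  qed
  then have "(\<Sum>\<gamma> \<in> annihilator G H. cnj (\<gamma> d)) = (\<Sum>\<gamma> \<in> annihilator G H. cnj (mul \<gamma> d))"
    by (rule sum.reindex_bij_betw[symmetric])
  also have "\<dots> = cnj (\<delta> d) * (\<Sum>\<gamma> \<in> annihilator G H. cnj (\<gamma> d))"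
    using d by (simp add: mul_def sum_distrib_left)
  finally show ?thesis
    using False \<delta>(2) by (metis complex_cnj_cnj complex_cnj_one mult_cancel_right1)
qed

text \<open>The sum of \<open>cnj (\<gamma> g)\<close> over all \<open>g\<close> and all
  \<open>\<gamma>\<close> in the annihilator is evaluated in both orders: only \<open>g\<close> in
  \<open>H\<close> contribute in one, only the trivial character in the other.\<close>

lemma (in comm_group) card_annihilator:
  assumes fin: "finite (carrier G)" and H: "subgroup H G"
  shows "card (annihilator G H) * card H = order G"
proof -
  let ?one = "\<one>\<^bsub>dual_group G\<^esub>"
  have sub: "annihilator G H \<subseteq> carrier (dual_group G)" by (auto simp: annihilator_def)
  then have finA: "finite (annihilator G H)" using finite_dual_group[OF fin] finite_subset by blast
  have "complex_of_nat (card H * card (annihilator G H)) =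
      (\<Sum>g \<in> carrier G. if g \<in> H then of_nat (card (annihilator G H)) else 0)"
    using fin subgroup.subset[OF H] by (simp add: sum.If_cases Int_absorb1 flip: Int_def)
  also have "\<dots> = (\<Sum>g \<in> carrier G. \<Sum>\<gamma> \<in> annihilator G H. cnj (\<gamma> g))"
    by (simp add: sum_annihilator[OF fin H])
  also have "\<dots> = (\<Sum>\<gamma> \<in> annihilator G H. \<Sum>g \<in> carrier G. cnj (\<gamma> g))"
    by (rule sum.swap)
  also have "\<dots> = (\<Sum>\<gamma> \<in> annihilator G H. if \<gamma> = ?one then of_nat (order G) else 0)"
  proof (intro sum.cong refl)
    fix \<gamma> assume "\<gamma> \<in> annihilator G H"
    then show "(\<Sum>g \<in> carrier G. cnj (\<gamma> g)) = (if \<gamma> = ?one then of_nat (order G) else 0)"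
    proof (cases "\<gamma> = ?one")
      case True
      then show ?thesis by (simp add: dual_group_def order_def)
    qed (use sub sum_character_eq_0 in auto)
  qed
  also have "\<dots> = of_nat (order G)"
    using finA one_in_annihilator[OF H] by simp
  finally show ?thesis by (simp only: of_nat_eq_iff mult.commute)
qed

section \<open>A difference set disjoint from a subgroup\<close>

locale disjoint_difference_set = comm_group G for G (structure) +
  fixes D H :: "'a set"
  assumes fin: "finite (carrier G)"
    and diff: "difference_set G D"
    and D_ne: "D \<noteq> {}"
    and H: "subgroup H G"
    and disj: "D \<inter> H = {}"
begin

abbreviation N :: real where "N \<equiv> real (order G)"
abbreviation k :: real where "k \<equiv> real (card D)"
abbreviation h :: real where "h \<equiv> real (card H)"
abbreviation S :: real where "S \<equiv> diffset_S G D"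

text \<open>The right coset \<open>D #> inv g\<close> is the translate D - g of the additive
  notation.\<close>

definition section_card :: "'a \<Rightarrow> nat" where
  "section_card g = card (H \<inter> (D #> inv g))"

lemma D_sub: "D \<subseteq> carrier G"
  using diff by (simp add: difference_set_def)

lemma H_sub: "H \<subseteq> carrier G"
  by (rule subgroup.subset[OF H])

lemma fin_H: "finite H" and fin_D: "finite D"
  using fin H_sub D_sub finite_subset by auto

lemma k_pos: "0 < k"
  using fin_D D_ne by (simp add: card_gt_0_iff)

lemma h_pos: "0 < h"
  using fin_H subgroup.one_closed[OF H] by (auto simp: card_gt_0_iff)

text \<open>With \<open>k\<close> and \<open>h\<close> both at least 1, this gives the strict bounds
  that keep \<open>N - k\<close> and \<open>N - 1\<close> positive and make \<open>H\<close>
  proper.\<close>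

lemma k_h_le: "k + h \<le> N"
proof -
  have "card D + card H = card (D \<union> H)"
    using fin_D fin_H disj by (simp add: card_Un_disjoint)
  also have "\<dots> \<le> order G"
    using fin D_sub H_sub by (simp add: order_def card_mono)
  finally show ?thesis by linarith
qed

lemma h_ge_1: "1 \<le> h" and k_ge_1: "1 \<le> k"
  using h_pos k_pos by auto

lemma N_bounds: "1 < N" "k < N" "h < N"
  using h_ge_1 k_ge_1 k_h_le by auto

lemma S_sq: "S\<^sup>2 = k * (N - 1) / (N - k)"
  using N_bounds k_pos by (simp add: diffset_S_def)

lemma S_pos: "0 < S"
  using N_bounds k_pos by (simp add: diffset_S_def)

text \<open>The target semiring is left open because the sum is needed over \<open>nat\<close>,
  \<open>real\<close> and \<open>complex\<close>.\<close>

lemma card_section: "of_nat (section_card g) = (\<Sum>x \<in> H. indicator D (x \<otimes> g) :: 'c :: semiring_1)"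
  if "g \<in> carrier G"
proof -
  have "x \<in> D #> inv g \<longleftrightarrow> x \<otimes> g \<in> D" if "x \<in> H" for x
  proof
    assume "x \<in> D #> inv g"
    then show "x \<otimes> g \<in> D"
      using D_sub \<open>g \<in> carrier G\<close> by (auto simp: r_coset_def m_assoc subset_eq)
  next
    assume "x \<otimes> g \<in> D"
    then show "x \<in> D #> inv g"
      using H_sub that \<open>g \<in> carrier G\<close>
      by (auto simp: r_coset_def m_assoc subset_eq intro!: bexI[of _ "x \<otimes> g"])
  qed
  then have "(\<Sum>x \<in> H. indicator D (x \<otimes> g) :: 'c) = (\<Sum>x \<in> H. indicator (D #> inv g) x)"
    by (intro sum.cong) (auto simp: indicator_def)
  then show ?thesis
    using card_eq_sum_indicator[OF fin_H] by (simp add: section_card_def)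
qed

text \<open>Translation by an element of \<open>H\<close> keeps \<open>H\<close> inside itself, and
  \<open>D\<close> misses \<open>H\<close>. Sums over the group therefore reduce to the complement
  of \<open>H\<close>.\<close>

lemma section_card_subgroup: "section_card g = 0" if "g \<in> H"
proof -
  have "(\<Sum>x \<in> H. indicator D (x \<otimes> g) :: nat) = 0"
    using subgroup.m_closed[OF H _ that] disj by (intro sum.neutral) (auto simp: indicator_def)
  then show ?thesis
    using card_section[of g, where 'c = nat] that H_sub by auto
qed

section \<open>Fourier transform and moments of the section cardinalities\<close>

text \<open>Since \<open>\<gamma>\<close> is 1 on \<open>H\<close>, \<open>\<gamma> g\<close> may be
  replaced by \<open>\<gamma> (x \<otimes> g)\<close>; each \<open>x\<close> in \<open>H\<close>
  then contributes one full transform of \<open>D\<close>.\<close>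

lemma sum_cnj_section_card:
  assumes "\<gamma> \<in> annihilator G H"
  shows "(\<Sum>g \<in> carrier G. cnj (\<gamma> g) * of_nat (section_card g)) =
    of_nat (card H) * dft G (indicator D) \<gamma>"
proof -
  have \<gamma>: "\<gamma> \<in> carrier (dual_group G)" "\<And>x. x \<in> H \<Longrightarrow> \<gamma> x = 1"
    using assms by (auto simp: annihilator_def)
  have "(\<Sum>g \<in> carrier G. cnj (\<gamma> g) * of_nat (section_card g)) =
      (\<Sum>g \<in> carrier G. \<Sum>x \<in> H. cnj (\<gamma> (x \<otimes> g)) * indicator D (x \<otimes> g))"
    using H_sub \<gamma> by (intro sum.cong) (auto simp: card_section sum_distrib_left dual_groupD(1)[OF \<gamma>(1)] subset_eq)
  also have "\<dots> = (\<Sum>x \<in> H. \<Sum>g \<in> carrier G. cnj (\<gamma> (x \<otimes> g)) * indicator D (x \<otimes> g))"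
    by (rule sum.swap)
  also have "\<dots> = (\<Sum>x \<in> H. dft G (indicator D) \<gamma>)"
    unfolding dft_def using H_sub by (intro sum.cong refl sum_translate) auto
  finally show ?thesis by simp
qed

lemma sum_section_card: "(\<Sum>g \<in> carrier G. real (section_card g)) = h * k"
proof -
  have "(\<Sum>g \<in> carrier G. real (section_card g)) = (\<Sum>x \<in> H. \<Sum>g \<in> carrier G. indicator D (x \<otimes> g))"
    by (subst sum.swap) (simp add: card_section)
  also have "\<dots> = (\<Sum>x \<in> H. \<Sum>g \<in> carrier G. indicator D g)"
    using H_sub by (intro sum.cong refl sum_translate) auto
  also have "\<dots> = h * k"
    using card_eq_sum_indicator[OF fin, of D, where 'c = real] D_sub by (simp add: Int_absorb1)
  finally show ?thesis .
qed

text \<open>Expanding the square gives a sum over pairs \<open>x\<close>, \<open>y\<close> in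
  \<open>H\<close> of the number of representations of \<open>inv y \<otimes> x\<close>, which is
  \<open>k\<close> on the diagonal and Lambda elsewhere.\<close>

lemma sum_section_card_sq:
  "(\<Sum>g \<in> carrier G. (real (section_card g))\<^sup>2) = h * (k + (h - 1) * diffset_Lambda G D)"
proof -
  have "(\<Sum>g \<in> carrier G. (real (section_card g))\<^sup>2) =
      (\<Sum>g \<in> carrier G. \<Sum>x \<in> H. \<Sum>y \<in> H. indicator D (x \<otimes> g) * indicator D (y \<otimes> g))"
    by (simp add: card_section power2_eq_square sum_product)
  also have "\<dots> = (\<Sum>x \<in> H. \<Sum>g \<in> carrier G. \<Sum>y \<in> H. indicator D (x \<otimes> g) * indicator D (y \<otimes> g))"
    by (rule sum.swap)
  also have "\<dots> = (\<Sum>x \<in> H. \<Sum>y \<in> H. \<Sum>g \<in> carrier G. indicator D (x \<otimes> g) * indicator D (y \<otimes> g))"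
    by (intro sum.cong refl sum.swap)
  also have "\<dots> = (\<Sum>x \<in> H. \<Sum>y \<in> H. real (card (difference_reps G D (inv y \<otimes> x))))"
  proof (intro sum.cong refl)
    fix x y assume xy: "x \<in> H" "y \<in> H"
    then have carr: "x \<in> carrier G" "y \<in> carrier G" using H_sub by auto
    \<comment> \<open>Both factors are expressed through \<open>y \<otimes> g\<close>, so that
      \<open>sum_translate\<close> applies.\<close>
    have "(\<Sum>g \<in> carrier G. indicator D (x \<otimes> g) * indicator D (y \<otimes> g) :: real) =
        (\<Sum>g \<in> carrier G. indicator D (inv y \<otimes> x \<otimes> (y \<otimes> g)) * indicator D (y \<otimes> g))"
    proof (intro sum.cong refl)
      fix g assume g: "g \<in> carrier G"
      have "inv y \<otimes> x \<otimes> (y \<otimes> g) = x \<otimes> (inv y \<otimes> (y \<otimes> g))"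
        using carr g by (simp add: m_ac)
      also have "\<dots> = x \<otimes> g"
        using carr g by (simp add: m_assoc[symmetric])
      finally show "indicator D (x \<otimes> g) * indicator D (y \<otimes> g) =
          (indicator D (inv y \<otimes> x \<otimes> (y \<otimes> g)) * indicator D (y \<otimes> g) :: real)" by simp
    qed
    also have "\<dots> = (\<Sum>g \<in> carrier G. indicator D (inv y \<otimes> x \<otimes> g) * indicator D g)"
      by (rule sum_translate[OF carr(2), of "\<lambda>g. indicator D (inv y \<otimes> x \<otimes> g) * indicator D g"])
    also have "\<dots> = real (card (difference_reps G D (inv y \<otimes> x)))"
      using carr fin D_sub by (simp add: card_difference_reps)
    finally show "(\<Sum>g \<in> carrier G. indicator D (x \<otimes> g) * indicator D (y \<otimes> g)) =
        real (card (difference_reps G D (inv y \<otimes> x)))" .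
  qed
  also have "\<dots> = (\<Sum>x \<in> H. \<Sum>y \<in> H. if y = x then k else diffset_Lambda G D)"
  proof (intro sum.cong refl)
    fix x y assume xy: "x \<in> H" "y \<in> H"
    then have carr: "x \<in> carrier G" "y \<in> carrier G" using H_sub by auto
    then have "inv y \<otimes> x = \<one> \<longleftrightarrow> y = x"
      by (metis inv_equality inv_inv inv_closed l_inv)
    then show "real (card (difference_reps G D (inv y \<otimes> x))) = (if y = x then k else diffset_Lambda G D)"
      using carr card_difference_reps_one[OF D_sub] card_difference_set_reps[OF fin diff] by auto
  qed
  also have "\<dots> = (\<Sum>x \<in> H. k + (h - 1) * diffset_Lambda G D)"
  proof (intro sum.cong refl)
    fix x assume "x \<in> H"
    then have "(\<Sum>y \<in> H. if y = x then k else diffset_Lambda G D) =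
        k + (\<Sum>y \<in> H - {x}. diffset_Lambda G D)"
      using fin_H by (subst sum.remove[of _ x]) (auto intro!: sum.cong)
    also have "\<dots> = k + (h - 1) * diffset_Lambda G D"
      using fin_H \<open>x \<in> H\<close> h_ge_1 by (simp add: of_nat_diff)
    finally show "(\<Sum>y \<in> H. if y = x then k else diffset_Lambda G D) =
        k + (h - 1) * diffset_Lambda G D" .
  qed
  finally show ?thesis by simp
qed

text \<open>The bound \<open>h \<le> N / (S + 1)\<close> of the theorem is equivalent to \<open>S \<le> t\<close>.\<close>
definition t :: real where "t = N / h - 1"

lemma t_pos: "0 < t"
  using N_bounds h_pos by (simp add: t_def)

text \<open>Eliminating \<open>N\<close> in favour of \<open>h\<close> and \<open>t\<close> turns
  the numerators below into polynomials.\<close>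

lemma N_eq: "N = h * (t + 1)"
  using h_pos by (simp add: t_def)

section \<open>The variance off the subgroup, the bound on its order, and constancy of the
  sections\<close>

text \<open>The number \<open>k / t\<close> is the mean off \<open>H\<close>: a total of
  \<open>h * k\<close> is spread over \<open>N - h = h * t\<close> elements. All factors on the
  right except \<open>t\<^sup>2 - S\<^sup>2\<close> are positive.\<close>

lemma variance:
  "(\<Sum>g \<in> carrier G - H. (real (section_card g) - k / t)\<^sup>2) =
    h\<^sup>2 * k * (N - k) * (t\<^sup>2 - S\<^sup>2) / ((N - 1) * N * t)"
proof -
  \<comment> \<open>This covers the first and second moments; the constant term does not vanish on
    \<open>H\<close> and is summed over the \<open>N - h\<close> elements directly.\<close>
  have restrict_H: "(\<Sum>g \<in> carrier G - H. f (section_card g)) = (\<Sum>g \<in> carrier G. f (section_card g))"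
    if "f 0 = 0" for f :: "nat \<Rightarrow> real"
    using fin section_card_subgroup that by (intro sum.mono_neutral_left) auto
  have "(\<Sum>g \<in> carrier G - H. (real (section_card g) - k / t)\<^sup>2) =
      (\<Sum>g \<in> carrier G - H. (real (section_card g))\<^sup>2) -
      2 * (k / t) * (\<Sum>g \<in> carrier G - H. real (section_card g)) +
      (\<Sum>g \<in> carrier G - H. (k / t)\<^sup>2)"
    by (simp add: power2_diff sum.distrib sum_subtractf sum_distrib_left algebra_simps)
  also have "\<dots> = h * (k + (h - 1) * diffset_Lambda G D) - 2 * (k / t) * (h * k) + (N - h) * (k / t)\<^sup>2"
  proof -
    have "real (card (carrier G - H)) = N - h"
      using fin_H H_sub N_bounds by (simp add: card_Diff_subset order_def of_nat_diff)
    then show ?thesis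
      using restrict_H[of "\<lambda>m. (real m)\<^sup>2"] restrict_H[of real]
      by (simp add: sum_section_card sum_section_card_sq)
  qed
  also have "\<dots> = h * (k + (h - 1) * diffset_Lambda G D - k\<^sup>2 / t)"
    using t_pos by (simp add: N_eq field_simps power2_eq_square)
  also have "\<dots> = h * k * (h * t\<^sup>2 - k * t - k * h + k) / ((N - 1) * t)"
  proof -
    have nz: "N - 1 \<noteq> 0" "t \<noteq> 0" using N_bounds t_pos by auto
    have "k * (N - 1) * t + (h - 1) * (k * (k - 1)) * t - k\<^sup>2 * (N - 1) = k * (h * t\<^sup>2 - k * t - k * h + k)"
      by (simp add: N_eq algebra_simps power2_eq_square)
    moreover have "k + (h - 1) * diffset_Lambda G D - k\<^sup>2 / t =
        (k * (N - 1) * t + (h - 1) * (k * (k - 1)) * t - k\<^sup>2 * (N - 1)) / ((N - 1) * t)"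
      using nz by (simp only: diffset_Lambda_def diff_divide_distrib add_divide_distrib) simp
    ultimately show ?thesis by simp
  qed
  also have "\<dots> = h\<^sup>2 * k * (N - k) * (t\<^sup>2 - S\<^sup>2) / ((N - 1) * N * t)"
  proof -
    \<comment> \<open>The remaining polynomial times \<open>t + 1\<close> is
      \<open>(N - k) * (t\<^sup>2 - S\<^sup>2)\<close>. As \<open>h * (t + 1) = N\<close>, extending
      the fraction by \<open>N\<close> produces this factor.\<close>
    have "N - k \<noteq> 0" using N_bounds by simp
    then have "(N - k) * S\<^sup>2 = k * (N - 1)"
      unfolding S_sq times_divide_eq_right by (rule nonzero_mult_div_cancel_left)
    then have "(N - k) * (t\<^sup>2 - S\<^sup>2) = (N - k) * t\<^sup>2 - k * (N - 1)"
      by (simp only: right_diff_distrib[of "N - k"])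
    also have "\<dots> = (t + 1) * (h * t\<^sup>2 - k * t - k * h + k)"
      by (simp add: N_eq algebra_simps power2_eq_square)
    finally have *: "(N - k) * (t\<^sup>2 - S\<^sup>2) = (t + 1) * (h * t\<^sup>2 - k * t - k * h + k)" .
    have num: "h\<^sup>2 * k * (N - k) * (t\<^sup>2 - S\<^sup>2) = N * (h * k * (h * t\<^sup>2 - k * t - k * h + k))"
      unfolding mult.assoc * by (simp add: N_eq power2_eq_square)
    have "N \<noteq> 0" using N_bounds by simp
    then show ?thesis
      unfolding num unfolding mult.assoc mult.left_commute[of "N - 1" N]
      by (rule mult_divide_mult_cancel_left[symmetric])
  qed
  finally show ?thesis .
qed

lemma S_le_t: "S \<le> t"
proof -
  have "0 \<le> h\<^sup>2 * k * (N - k) * (t\<^sup>2 - S\<^sup>2) / ((N - 1) * N * t)"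
    unfolding variance[symmetric] by (rule sum_nonneg) simp
  moreover have "0 < h\<^sup>2 * k * (N - k)" "0 < (N - 1) * N * t"
    using h_pos k_pos N_bounds t_pos by simp_all
  ultimately have "0 \<le> t\<^sup>2 - S\<^sup>2"
    by (simp only: zero_le_divide_iff zero_le_mult_iff) auto
  then have "S\<^sup>2 \<le> t\<^sup>2" by simp
  then show ?thesis
    using t_pos by (rule power2_le_imp_le[OF _ less_imp_le])
qed

lemma h_le: "h \<le> N / (S + 1)"
proof -
  have "h * (S + 1) \<le> N"
    unfolding N_eq using S_le_t h_pos by (intro mult_left_mono) auto
  then show ?thesis
    using S_pos by (simp add: pos_le_divide_eq)
qed

lemma fine_wrt_iff_t: "fine_wrt G H D \<longleftrightarrow> t = S"
  using diff D_ne H disj S_pos h_pos by (auto simp: fine_wrt_def t_def field_simps)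

text \<open>At \<open>t = S\<close> the variance is 0, and so is each of its squares.\<close>

lemma section_card_if_fine:
  assumes "t = S" "g \<in> carrier G - H"
  shows "real (section_card g) = k / S"
proof -
  have "(\<Sum>g \<in> carrier G - H. (real (section_card g) - k / t)\<^sup>2) = 0"
    using variance by (simp add: assms(1))
  then show ?thesis
    using assms fin by (simp add: sum_nonneg_eq_0_iff)
qed

text \<open>The first moment suffices: the constant \<open>k / S\<close> on \<open>h * t\<close>
  elements must add up to \<open>h * k\<close>.\<close>

lemma fine_if_section_card:
  assumes "\<And>g. g \<in> carrier G - H \<Longrightarrow> real (section_card g) = k / S"
  shows "t = S"
proof -
  have "h * k = (\<Sum>g \<in> carrier G - H. real (section_card g))"
    unfolding sum_section_card[symmetric] using fin section_card_subgroup
    by (intro sum.mono_neutral_right) auto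
  also have "\<dots> = (N - h) * (k / S)"
    using assms fin_H H_sub N_bounds by (simp add: card_Diff_subset order_def of_nat_diff)
  finally have "h * k * S = h * k * t"
    using S_pos by (simp add: N_eq field_simps)
  then show ?thesis
    using h_pos k_pos by simp
qed

lemma fine_wrt_iff_section_card:
  "fine_wrt G H D \<longleftrightarrow> (\<forall>g \<in> carrier G - H. real (section_card g) = k / S)"
  unfolding fine_wrt_iff_t using section_card_if_fine fine_if_section_card by blast

text \<open>Substituting \<open>g \<otimes> a\<close> for the summation variable turns the argument
  of the indicator of \<open>H\<close> into \<open>inv a\<close>, and \<open>H\<close> is closed
  under inversion.\<close>

lemma convolution_indicator:
  assumes "g \<in> carrier G"
  shows "convolution G (indicator D) (indicator H) g = of_nat (section_card g)"
proof -
  have "complex_of_nat (section_card g) =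
      (\<Sum>a \<in> carrier G. indicator H a * indicator D (a \<otimes> g))"
    unfolding card_section[OF assms] using fin H_sub
    by (intro sum.mono_neutral_cong_left) (auto simp: indicator_def)
  also have "\<dots> = (\<Sum>a \<in> carrier G. indicator D (g \<otimes> a) * indicator H (g \<otimes> inv (g \<otimes> a)))"
  proof (intro sum.cong refl)
    fix a assume a: "a \<in> carrier G"
    have "g \<otimes> inv (g \<otimes> a) = inv a"
      using a assms by (simp add: inv_mult_group m_comm[of "inv a"] m_assoc[symmetric])
    moreover have "inv a \<in> H \<longleftrightarrow> a \<in> H"
      using subgroup.m_inv_closed[OF H] a inv_inv by metis
    ultimately show "indicator H a * indicator D (a \<otimes> g) =
        (indicator D (g \<otimes> a) * indicator H (g \<otimes> inv (g \<otimes> a)) :: complex)"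
      using a assms by (simp add: indicator_def m_comm)
  qed
  also have "\<dots> = convolution G (indicator D) (indicator H) g"
    unfolding convolution_def
    by (rule sum_translate[OF assms, of "\<lambda>b. indicator D b * indicator H (g \<otimes> inv b)"])
  finally show ?thesis ..
qed

text \<open>On \<open>H\<close> both sides are 0 in any case, so the identity only speaks about the
  complement.\<close>

lemma fine_wrt_iff_convolution:
  "fine_wrt G H D \<longleftrightarrow> (\<forall>g \<in> carrier G. convolution G (indicator D) (indicator H) g =
    complex_of_real (k / S) * indicator (carrier G - H) g)"
proof -
  have "convolution G (indicator D) (indicator H) g =
      complex_of_real (k / S) * indicator (carrier G - H) g \<longleftrightarrow>
      (g \<notin> H \<longrightarrow> real (section_card g) = k / S)" if "g \<in> carrier G" for g
  proof -
    have "complex_of_nat (section_card g) = complex_of_real (k / S) \<longleftrightarrow> real (section_card g) = k / S"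
      by (metis of_real_eq_iff of_real_of_nat_eq)
    then show ?thesis
      using that by (simp add: convolution_indicator section_card_subgroup indicator_def)
  qed
  then show ?thesis unfolding fine_wrt_iff_section_card by blast
qed

section \<open>The Fourier condition on the annihilator\<close>

text \<open>With sections constant off \<open>H\<close>, what remains is the sum of
  \<open>cnj (\<gamma> g)\<close> over the complement of \<open>H\<close>. It is \<open>- h\<close>,
  as \<open>\<gamma>\<close> sums to 0 over the group and is 1 on \<open>H\<close>.\<close>

lemma dft_if_fine:
  assumes fine: "fine_wrt G H D" and \<gamma>: "\<gamma> \<in> annihilator G H" "\<gamma> \<noteq> \<one>\<^bsub>dual_group G\<^esub>"
  shows "dft G (indicator D) \<gamma> = - complex_of_real (k / S)"
proof -
  have \<gamma>': "\<gamma> \<in> carrier (dual_group G)" "\<And>x. x \<in> H \<Longrightarrow> \<gamma> x = 1"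
    using \<gamma>(1) by (auto simp: annihilator_def)
  have val: "complex_of_nat (section_card g) = complex_of_real (k / S)" if "g \<in> carrier G - H" for g
    using fine that unfolding fine_wrt_iff_section_card by (metis of_real_of_nat_eq)
  have "of_nat (card H) * dft G (indicator D) \<gamma> =
      (\<Sum>g \<in> carrier G - H. cnj (\<gamma> g) * of_nat (section_card g))"
    unfolding sum_cnj_section_card[OF \<gamma>(1), symmetric] using fin section_card_subgroup
    by (intro sum.mono_neutral_right) auto
  also have "\<dots> = (\<Sum>g \<in> carrier G - H. cnj (\<gamma> g)) * complex_of_real (k / S)"
    unfolding sum_distrib_right by (intro sum.cong refl) (simp only: val)
  also have "(\<Sum>g \<in> carrier G - H. cnj (\<gamma> g)) = - of_nat (card H)"
    using sum_character_eq_0[OF \<gamma>'(1) \<gamma>(2)] sum.subset_diff[OF H_sub fin, of "\<lambda>g. cnj (\<gamma> g)"] \<gamma>'(2)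
    by (simp add: add_eq_0_iff2)
  finally have "of_nat (card H) * dft G (indicator D) \<gamma> = of_nat (card H) * - complex_of_real (k / S)"
    by simp
  then show ?thesis
    using h_pos by (metis mult_left_cancel of_nat_0 of_nat_eq_iff order_less_irrefl)
qed

text \<open>A case of Poisson summation: after the interchange the inner character sum is supported
  on \<open>H\<close>, where the indicator of \<open>D\<close> is 0.\<close>

lemma sum_dft_annihilator: "(\<Sum>\<gamma> \<in> annihilator G H. dft G (indicator D) \<gamma>) = 0"
proof -
  have "(\<Sum>\<gamma> \<in> annihilator G H. dft G (indicator D) \<gamma>) =
      (\<Sum>g \<in> carrier G. (\<Sum>\<gamma> \<in> annihilator G H. cnj (\<gamma> g)) * indicator D g)"
    unfolding dft_def sum_distrib_right by (rule sum.swap)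
  also have "\<dots> = 0"
    using disj by (intro sum.neutral) (auto simp: sum_annihilator[OF fin H] indicator_def)
  finally show ?thesis .
qed

text \<open>The annihilator has \<open>N / h = t + 1\<close> elements. The trivial one contributes
  \<open>k\<close> and each of the other \<open>t\<close> contributes \<open>- k / S\<close>, so a
  total of 0 forces \<open>t = S\<close>.\<close>

lemma fine_if_dft:
  assumes "\<And>\<gamma>. \<gamma> \<in> annihilator G H \<Longrightarrow> \<gamma> \<noteq> \<one>\<^bsub>dual_group G\<^esub> \<Longrightarrow>
    dft G (indicator D) \<gamma> = - complex_of_real (k / S)"
  shows "fine_wrt G H D"
proof -
  let ?A = "annihilator G H" and ?one = "\<one>\<^bsub>dual_group G\<^esub>"
  have finA: "finite ?A"
    using finite_dual_group[OF fin] by (rule rev_finite_subset) (auto simp: annihilator_def)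
  have one: "?one \<in> ?A" by (rule one_in_annihilator[OF H])
  have "dft G (indicator D) ?one = complex_of_real k"
    using card_eq_sum_indicator[OF fin, of D, where 'c = complex] D_sub
    by (simp add: dft_def dual_group_def Int_absorb1)
  then have "complex_of_real k + (\<Sum>\<gamma> \<in> ?A - {?one}. - complex_of_real (k / S)) = 0"
    using sum_dft_annihilator assms by (simp add: sum.remove[OF finA one])
  moreover have "of_nat (card (?A - {?one})) = complex_of_real t"
  proof -
    have "real (card ?A) * h = N"
      using card_annihilator[OF fin H] by (metis of_nat_mult)
    then have "real (card ?A) = t + 1"
      using h_pos by (simp add: t_def field_simps)
    moreover have "card ?A = Suc (card (?A - {?one}))"
      using card_Suc_Diff1[OF finA one] by simp
    ultimately have "real (card (?A - {?one})) = t" by simp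
    then show ?thesis by (metis of_real_of_nat_eq)
  qed
  ultimately have "complex_of_real (k - t * (k / S)) = 0"
    by simp
  then have "k * S = k * t"
    unfolding of_real_eq_0_iff using S_pos by (simp add: field_simps)
  then show ?thesis
    using k_pos by (simp add: fine_wrt_iff_t)
qed

end

section \<open>The equivalences assembled, and the arithmetic of fine difference sets\<close>

theorem theorem3p3:
  fixes G :: "('a, 'b) monoid_scheme" and D :: "'a set"
  assumes "comm_group G" and "finite (carrier G)"
    and "difference_set G D" and "D \<noteq> {}"
  shows "(\<forall>H. subgroup H G \<and> D \<inter> H = {} \<longrightarrow>
      real (card H) \<le> real (order G) / (diffset_S G D + 1) \<and>
      (real (card H) = real (order G) / (diffset_S G D + 1) \<longleftrightarrow> fine_wrt G H D) \<and>
      (fine_wrt G H D \<longleftrightarrow>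
        (\<forall>\<gamma> \<in> annihilator G H. \<gamma> \<noteq> \<one>\<^bsub>dual_group G\<^esub> \<longrightarrow>
          dft G (indicator D) \<gamma> = - complex_of_real (real (card D) / diffset_S G D))) \<and>
      (fine_wrt G H D \<longleftrightarrow>
        (\<forall>g \<in> carrier G - H.
          real (card (H \<inter> (D #>\<^bsub>G\<^esub> inv\<^bsub>G\<^esub> g))) = real (card D) / diffset_S G D)) \<and>
      (fine_wrt G H D \<longleftrightarrow>
        (\<forall>g \<in> carrier G. convolution G (indicator D) (indicator H) g =
          complex_of_real (real (card D) / diffset_S G D) * indicator (carrier G - H) g)))
    \<and> (fine G D \<longrightarrow>
      (\<exists>s::int. diffset_S G D = of_int s \<and> s dvd int (card D)) \<and>
      (\<forall>g \<in> carrier G - {\<one>\<^bsub>G\<^esub>}. real (card (difference_reps G D g)) = diffset_Lambda G D) \<and>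
      real (card D) - diffset_Lambda G D = (real (card D))\<^sup>2 / (diffset_S G D)\<^sup>2 \<and>
      (\<exists>n::nat. real (card D) - diffset_Lambda G D = real (n\<^sup>2)))"
proof (rule conjI; intro allI impI)
  interpret comm_group G by fact
  fix H assume "subgroup H G \<and> D \<inter> H = {}"
  then interpret disjoint_difference_set G D H
    using assms by (intro disjoint_difference_set.intro disjoint_difference_set_axioms.intro) auto
  show "real (card H) \<le> real (order G) / (diffset_S G D + 1) \<and>
      (real (card H) = real (order G) / (diffset_S G D + 1) \<longleftrightarrow> fine_wrt G H D) \<and>
      (fine_wrt G H D \<longleftrightarrow>
        (\<forall>\<gamma> \<in> annihilator G H. \<gamma> \<noteq> \<one>\<^bsub>dual_group G\<^esub> \<longrightarrow>
          dft G (indicator D) \<gamma> = - complex_of_real (real (card D) / diffset_S G D))) \<and>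
      (fine_wrt G H D \<longleftrightarrow>
        (\<forall>g \<in> carrier G - H.
          real (card (H \<inter> (D #>\<^bsub>G\<^esub> inv\<^bsub>G\<^esub> g))) = real (card D) / diffset_S G D)) \<and>
      (fine_wrt G H D \<longleftrightarrow>
        (\<forall>g \<in> carrier G. convolution G (indicator D) (indicator H) g =
          complex_of_real (real (card D) / diffset_S G D) * indicator (carrier G - H) g))"
  proof (intro conjI)
    show "real (card H) = real (order G) / (diffset_S G D + 1) \<longleftrightarrow> fine_wrt G H D"
      using diff D_ne H disj by (simp add: fine_wrt_def)
    show "fine_wrt G H D \<longleftrightarrow>
        (\<forall>\<gamma> \<in> annihilator G H. \<gamma> \<noteq> \<one>\<^bsub>dual_group G\<^esub> \<longrightarrow>
          dft G (indicator D) \<gamma> = - complex_of_real (real (card D) / diffset_S G D))"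
      using dft_if_fine fine_if_dft by blast
  qed (fact h_le fine_wrt_iff_section_card[unfolded section_card_def] fine_wrt_iff_convolution)+
next
  interpret comm_group G by fact
  assume "fine G D"
  then obtain H where fine: "fine_wrt G H D" by (auto simp: fine_def)
  then interpret disjoint_difference_set G D H
    using assms by (intro disjoint_difference_set.intro disjoint_difference_set_axioms.intro) (auto simp: fine_wrt_def)
  \<comment> \<open>Some \<open>g\<close> lies off \<open>H\<close>; its section cardinality is a
    natural number equal to \<open>k / S\<close> and witnesses both the divisibility and the perfect
    square.\<close>
  have "H \<noteq> carrier G" using N_bounds by (auto simp: order_def)
  then obtain g where g: "g \<in> carrier G - H"
    using H_sub by blast
  have quot: "real (section_card g) = k / S"
    using fine g by (simp add: fine_wrt_iff_section_card)
  \<comment> \<open>The index \<open>i\<close> of \<open>H\<close> is \<open>N / h\<close>, so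
    fineness, in the form \<open>t = S\<close>, gives \<open>S = i - 1\<close>.\<close>
  obtain i where i: "order G = card H * i"
    using lagrange[OF H] by (metis mult.commute)
  have S_int: "S = of_int (int i - 1)"
  proof -
    have "N / h = real i" using h_pos by (simp add: i)
    then show ?thesis using fine by (simp add: fine_wrt_iff_t t_def)
  qed
  have order: "k - diffset_Lambda G D = k\<^sup>2 / S\<^sup>2"
  proof -
    have "N - 1 \<noteq> 0" using N_bounds by simp
    then have "k - diffset_Lambda G D = k * (N - k) / (N - 1)"
      by (simp add: diffset_Lambda_def field_simps)
    \<comment> \<open>The extra factor \<open>k\<close> lets \<open>k * (N - 1) / (N - k)\<close>,
      that is \<open>S\<^sup>2\<close>, appear as the denominator.\<close>
    also have "\<dots> = k * (k * (N - k)) / (k * (N - 1))"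
      using k_pos by (simp only: mult_divide_mult_cancel_left)
    also have "\<dots> = k\<^sup>2 / S\<^sup>2"
      unfolding S_sq by (simp only: power2_eq_square divide_divide_eq_right mult.assoc)
    finally show ?thesis .
  qed
  show "(\<exists>s::int. diffset_S G D = of_int s \<and> s dvd int (card D)) \<and>
      (\<forall>g \<in> carrier G - {\<one>\<^bsub>G\<^esub>}. real (card (difference_reps G D g)) = diffset_Lambda G D) \<and>
      real (card D) - diffset_Lambda G D = (real (card D))\<^sup>2 / (diffset_S G D)\<^sup>2 \<and>
      (\<exists>n::nat. real (card D) - diffset_Lambda G D = real (n\<^sup>2))"
  proof (intro conjI exI ballI)
    \<comment> \<open>The cofactor is \<open>section_card g\<close>; the equation holds over the
      reals and is pulled back to the integers.\<close>
    have "real_of_int (int (card D)) = real_of_int ((int i - 1) * int (section_card g))"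
      using quot S_pos unfolding of_int_mult S_int[symmetric] by (simp add: field_simps)
    then show "int i - 1 dvd int (card D)"
      unfolding of_int_eq_iff by simp
    show "k - diffset_Lambda G D = real ((section_card g)\<^sup>2)"
      by (simp add: order quot power_divide)
  qed (use S_int order card_difference_set_reps[OF fin diff] in auto)
qed

end
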